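(* Let $X$ be an infinite set. Then $Top(X)$ is not an $F_\sigma$ set in $2^{\mathcal{P}(X)}$.
   Context: $2^{\mathcal{P}(X)}$ is the set $\mathcal{P}(\mathcal{P}(X))$ of all families of subsets of $X$ with the product topology ($2=\{0,1\}$ discrete); a subbase of open sets is given by $A^+ = \{x : A \in x\}$ and $A^- = \{x : A \notin x\}$ for $A \subseteq X$. $Top(X) \subseteq 2^{\mathcal{P}(X)}$ is the set of all topologies on $X$ (each topology regarded as its family of open sets). *)

theory Defs
  imports "HOL-Analysis.Analysis"
begin

text \<open>The characteristic function \<open>Pow X \<rightarrow> 2\<close> of a family of subsets of \<open>X\<close>; functions with
  domain \<open>Pow X\<close> are extensional, as in the library's product topology.\<close>

definition family_indicator :: "'a set \<Rightarrow> 'a set set \<Rightarrow> 'a set \<Rightarrow> bool" where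
  "family_indicator X x = (\<lambda>A\<in>Pow X. A \<in> x)"

text \<open>The space \<open>2\<^bsup>P(X)\<^esup>\<close>: its points are the families of subsets of \<open>X\<close>, and its topology is the
  product topology of discrete two-point spaces, transported along the bijection
  \<open>family_indicator X\<close>.\<close>

definition family_space :: "'a set \<Rightarrow> 'a set set topology" where
  "family_space X = pullback_topology (Pow (Pow X)) (family_indicator X)
     (product_topology (\<lambda>_. discrete_topology (UNIV :: bool set)) (Pow X))"

definition Top :: "'a set \<Rightarrow> 'a set set set" where
  "Top X = {{U. openin T U} | T. topspace T = X}"

lemma bij_betw_family_indicator:
  "bij_betw (family_indicator X) (Pow (Pow X)) (Pow X \<rightarrow>\<^sub>E (UNIV :: bool set))"
proof (rule bij_betw_byWitness[where f' = "\<lambda>f. {A \<in> Pow X. f A}"])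
  show "\<forall>f\<in>Pow X \<rightarrow>\<^sub>E (UNIV :: bool set). family_indicator X {A \<in> Pow X. f A} = f"
    by (auto simp: family_indicator_def fun_eq_iff PiE_def extensional_def)
next
  show "family_indicator X ` Pow (Pow X) \<subseteq> Pow X \<rightarrow>\<^sub>E UNIV"
    unfolding family_indicator_def by (intro image_subsetI restrict_PiE_iff[THEN iffD2]) simp
qed (auto simp: family_indicator_def)

lemma topspace_family_space: "topspace (family_space X) = Pow (Pow X)"
  by (auto simp: family_space_def topspace_pullback_topology family_indicator_def)

lemma Top_subset: "Top X \<subseteq> Pow (Pow X)"
  by (auto simp: Top_def dest: openin_subset)

lemma Top_iff_istopology:
  "x \<in> Top X \<longleftrightarrow> istopology (\<lambda>U. U \<in> x) \<and> \<Union>x = X"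
proof
  assume "x \<in> Top X"
  then obtain T where T: "topspace T = X" "x = {U. openin T U}"
    by (auto simp: Top_def)
  then show "istopology (\<lambda>U. U \<in> x) \<and> \<Union>x = X"
    by (simp add: topspace_def)
next
  assume *: "istopology (\<lambda>U. U \<in> x) \<and> \<Union>x = X"
  define T where "T = topology (\<lambda>U. U \<in> x)"
  have "openin T = (\<lambda>U. U \<in> x)"
    using * by (simp add: T_def)
  then have "x = {U. openin T U}" "topspace T = X"
    using * by (auto simp: topspace_def)
  then show "x \<in> Top X"
    by (auto simp: Top_def)
qed

text \<open>The sets \<open>A\<^sup>+\<close> and \<open>A\<^sup>-\<close> form a subbase.\<close>

lemma family_space_subbase:
  "family_space X = topology_generated_by
     ((\<lambda>A. {x \<in> Pow (Pow X). A \<in> x}) ` Pow X \<union> (\<lambda>A. {x \<in> Pow (Pow X). A \<notin> x}) ` Pow X)"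
  (is "_ = topology_generated_by ?S")
proof -
  define S where "S = ?S"
  define P where "P = product_topology (\<lambda>_. discrete_topology (UNIV :: bool set)) (Pow X)"
  define h where "h A b = {x \<in> Pow (Pow X). (A \<in> x) = b}" for A b
  have hS: "h A b \<in> S" if "A \<in> Pow X" for A b
    using that by (cases b) (simp_all add: h_def S_def)
  have S_cases: "\<exists>A b. A \<in> Pow X \<and> s = h A b" if "s \<in> S" for s
  proof -
    from that consider A where "A \<in> Pow X" "s = h A True" | A where "A \<in> Pow X" "s = h A False"
      unfolding S_def h_def by auto
    then show ?thesis by cases blast+
  qed
  let ?G = "topology_generated_by S"
  have top: "topspace ?G = Pow (Pow X)"
    unfolding S_def by auto
  have ind: "family_indicator X x A = (A \<in> x)" if "A \<in> Pow X" for x A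
    using that by (simp add: family_indicator_def)
  have "continuous_map ?G (discrete_topology UNIV) (\<lambda>x. family_indicator X x A)"
    if A: "A \<in> Pow X" for A
  proof (unfold continuous_map_def, intro conjI allI impI)
    fix B :: "bool set"
    have "{x \<in> topspace ?G. family_indicator X x A \<in> B} = (\<Union>b\<in>B. h A b)"
      unfolding top ind[OF A] h_def by auto
    moreover have "openin ?G (\<Union>b\<in>B. h A b)"
      by (intro openin_Union ballI) (auto intro!: topology_generated_by_Basis hS[OF A])
    ultimately show "openin ?G {x \<in> topspace ?G. family_indicator X x A \<in> B}"
      by simp
  qed simp
  then have cont: "continuous_map ?G P (family_indicator X)"
    unfolding P_def continuous_map_componentwise
    by (simp add: family_indicator_def image_subset_iff)
  have "openin ?G U" if U: "openin (family_space X) U" for U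
  proof -
    obtain V where V: "openin P V" "U = family_indicator X -` V \<inter> Pow (Pow X)"
      using U unfolding family_space_def openin_pullback_topology P_def by blast
    have "U = {x \<in> topspace ?G. family_indicator X x \<in> V}"
      unfolding top V(2) by auto
    then show ?thesis
      using openin_continuous_map_preimage[OF cont V(1)] by simp
  qed
  moreover have "openin (family_space X) U" if U: "openin ?G U" for U
  proof -
    have sub: "openin (family_space X) (h A b)" if A: "A \<in> Pow X" for A b
    proof -
      have "continuous_map P (discrete_topology UNIV) (\<lambda>f. f A)"
        unfolding P_def by (rule continuous_map_product_projection[OF A])
      then have "openin P {f \<in> topspace P. f A \<in> {b}}"
        by (rule openin_continuous_map_preimage) simp
      moreover have "family_indicator X x \<in> topspace P" for x
        unfolding P_def by (simp add: family_indicator_def)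
      then have "h A b = family_indicator X -` {f \<in> topspace P. f A \<in> {b}} \<inter> Pow (Pow X)"
        unfolding h_def by (auto simp: ind[OF A])
      ultimately show ?thesis
        unfolding family_space_def openin_pullback_topology P_def by blast
    qed
    have gen: "openin (family_space X) s" if "s \<in> S" for s
      using S_cases[OF that] sub by blast
    have "generate_topology_on S U"
      using U by (simp add: openin_topology_generated_by_iff)
    then show ?thesis
      using generate_topology_on_coarsest[OF istopology_openin] gen by blast
  qed
  ultimately have "family_space X = ?G"
    unfolding topology_eq by blast
  then show ?thesis
    by (simp only: S_def)
qed

end

theory Submission
  imports Defs
begin

text \<open>The space of families is compact, so an \<open>F\<^sub>\<sigma>\<close> set is a countable union of compact sets
  \<open>F 0\<close>, \<open>F 1\<close>, ... The claim is that compact sets \<open>F n \<subseteq> Top X\<close> never exhaust \<open>Top X\<close>: a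
  diagonal argument produces a topology that lies in none of them.

  The candidates are taken from one simple class. Fix a point \<open>c\<close> of \<open>X\<close>; for a set \<open>D\<close> of
  points let every subset of \<open>X\<close> that contains \<open>c\<close> or misses \<open>D\<close> be open. This is a topology for
  every \<open>D\<close> (\<open>point_or_avoiding_in_Top\<close>). Now let \<open>B\<close> be an infinite set without \<open>c\<close>, and
  suppose that \<open>D\<close> meets \<open>B\<close> in the single point \<open>b\<close>. Then \<open>B\<close> is not open, while all singletons
  of points of \<open>B\<close> other than \<open>b\<close> are open. As \<open>b\<close> runs away through \<open>B\<close>, such topologies can
  only accumulate at families that contain every singleton \<open>{b'}\<close> with \<open>b' \<in> B\<close> but not the union
  \<open>B\<close>, and no such family is a topology. Hence a compact subset of \<open>Top X\<close> must, for some choice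
  of \<open>b \<in> B\<close>, exclude all topologies with \<open>D \<inter> B = {b}\<close>, whatever \<open>D\<close> does outside \<open>B\<close>
  (\<open>closed_subset_of_Top_misses_trace\<close>).

  Because that exclusion depends on the trace of \<open>D\<close> on \<open>B\<close> alone, the sets \<open>F n\<close> can be handled
  independently: split an infinite part of \<open>X - {c}\<close> into infinitely many disjoint infinite blocks
  and use the \<open>n\<close>-th block against \<open>F n\<close>. The set \<open>D\<close> of the points chosen in the blocks gives a
  topology outside all \<open>F n\<close>.\<close>

text \<open>Tychonoff's theorem gives compactness of the product of two-point spaces, and the inverse of
  the indicator map carries it over: that inverse is continuous into the pullback topology because
  its composition with the indicator map is the identity.\<close>

lemma compact_space_family_space: "compact_space (family_space X)"
proof -
  define P where "P = product_topology (\<lambda>_. discrete_topology (UNIV :: bool set)) (Pow X)"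
  define g where "g f = {A \<in> Pow X. f A}" for f :: "'a set \<Rightarrow> bool"
  have inverse: "family_indicator X (g f) = f" if "f \<in> topspace P" for f
    using that unfolding P_def family_indicator_def g_def
    by (auto simp: fun_eq_iff PiE_def extensional_def)
  have "compact_space P"
    unfolding P_def by (simp add: compact_space_product_topology compact_space_discrete_topology)
  have "continuous_map P P (family_indicator X \<circ> g)"
    by (rule continuous_map_eq[OF continuous_map_id]) (simp add: inverse)
  then have "continuous_map P (family_space X) g"
    unfolding family_space_def P_def[symmetric]
    by (rule continuous_map_pullback') (auto simp: g_def)
  moreover have "g ` topspace P = topspace (family_space X)"
  proof -
    have "g (family_indicator X x) = x" if "x \<in> Pow (Pow X)" for x
      using that by (auto simp: g_def family_indicator_def)
    moreover have "family_indicator X x \<in> topspace P" for x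
      by (simp add: P_def family_indicator_def)
    moreover have "g ` topspace P \<subseteq> Pow (Pow X)"
      by (auto simp: g_def)
    ultimately show ?thesis
      unfolding topspace_family_space by (metis image_eqI subsetI subset_antisym)
  qed
  ultimately show ?thesis
    using image_compactin[of P "topspace P" "family_space X" g] \<open>compact_space P\<close>
    by (simp add: compact_space_def)
qed

lemma closedin_family_space_member:
  assumes "A \<subseteq> X"
  shows "closedin (family_space X) {x \<in> Pow (Pow X). A \<in> x}"
    and "closedin (family_space X) {x \<in> Pow (Pow X). A \<notin> x}"
proof -
  have "openin (family_space X) {x \<in> Pow (Pow X). A \<in> x}"
    and "openin (family_space X) {x \<in> Pow (Pow X). A \<notin> x}"
    unfolding family_space_subbase using assms by (auto intro!: topology_generated_by_Basis)
  moreover have "Pow (Pow X) - {x \<in> Pow (Pow X). A \<in> x} = {x \<in> Pow (Pow X). A \<notin> x}"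
    and "Pow (Pow X) - {x \<in> Pow (Pow X). A \<notin> x} = {x \<in> Pow (Pow X). A \<in> x}"
    by auto
  ultimately show "closedin (family_space X) {x \<in> Pow (Pow X). A \<in> x}"
    and "closedin (family_space X) {x \<in> Pow (Pow X). A \<notin> x}"
    by (auto simp: closedin_def topspace_family_space)
qed

definition point_or_avoiding :: "'a set \<Rightarrow> 'a \<Rightarrow> 'a set \<Rightarrow> 'a set set" where
  "point_or_avoiding X c D = {U \<in> Pow X. c \<in> U \<or> U \<inter> D = {}}"

lemma point_or_avoiding_in_Top:
  assumes "c \<in> X"
  shows "point_or_avoiding X c D \<in> Top X"
proof -
  have "istopology (\<lambda>U. U \<in> point_or_avoiding X c D)"
    unfolding istopology_def
  proof (intro conjI allI impI)
    show "S \<inter> T \<in> point_or_avoiding X c D"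
      if "S \<in> point_or_avoiding X c D" "T \<in> point_or_avoiding X c D" for S T
      using that by (auto simp: point_or_avoiding_def)
    show "\<Union>\<K> \<in> point_or_avoiding X c D"
      if "\<forall>K\<in>\<K>. K \<in> point_or_avoiding X c D" for \<K>
      using that by (auto simp: point_or_avoiding_def)
  qed
  moreover have "X \<in> point_or_avoiding X c D"
    using assms by (simp add: point_or_avoiding_def)
  then have "\<Union>(point_or_avoiding X c D) = X"
    by (auto simp: point_or_avoiding_def)
  ultimately show ?thesis
    by (simp add: Top_iff_istopology)
qed

text \<open>If every \<open>{b}\<close> with \<open>b \<in> B\<close> were the trace on \<open>B\<close> of some \<open>D\<close> whose topology belongs to \<open>F\<close>, then any finitely
  many of the closed conditions \<open>x \<in> F\<close>, \<open>B \<notin> x\<close> and \<open>{b'} \<in> x\<close> (for \<open>b' \<in> B\<close>) could be met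
  together, by a \<open>b\<close> different from the finitely many points \<open>b'\<close> involved. Compactness would give
  one family that meets them all, although a topology containing all these singletons contains
  their union \<open>B\<close>.\<close>

lemma closed_subset_of_Top_misses_trace:
  assumes F: "closedin (family_space X) F" "F \<subseteq> Top X"
    and B: "B \<subseteq> X" "infinite B" "c \<notin> B"
  obtains b where "b \<in> B" "\<And>D. D \<inter> B = {b} \<Longrightarrow> point_or_avoiding X c D \<notin> F"
proof (rule ccontr)
  assume "\<not> thesis"
  then have "\<forall>b\<in>B. \<exists>D. D \<inter> B = {b} \<and> point_or_avoiding X c D \<in> F"
    using that by blast
  then obtain D where D: "\<And>b. b \<in> B \<Longrightarrow> D b \<inter> B = {b}"
      "\<And>b. b \<in> B \<Longrightarrow> point_or_avoiding X c (D b) \<in> F"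
    by metis
  define K where "K b' = {x \<in> F. B \<notin> x \<and> {b'} \<in> x}" for b'
  have closed: "closedin (family_space X) (K b')" if "b' \<in> B" for b'
  proof -
    have "K b' = F \<inter> {x \<in> Pow (Pow X). B \<notin> x} \<inter> {x \<in> Pow (Pow X). {b'} \<in> x}"
      using F(2) Top_subset[of X] unfolding K_def by blast
    then show ?thesis
      using that B(1) F(1) by (simp only:) (intro closedin_Int closedin_family_space_member; blast)
  qed
  have fip: "(\<Inter>b'\<in>C. K b') \<noteq> {}" if C: "finite C" "C \<subseteq> B" for C
  proof -
    obtain b where b: "b \<in> B" "b \<notin> C"
      using B(2) C by (meson finite_subset subsetI)
    have "B \<notin> point_or_avoiding X c (D b)"
      using D(1)[OF b(1)] B(3) by (auto simp: point_or_avoiding_def)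
    moreover have "{b'} \<in> point_or_avoiding X c (D b)" if "b' \<in> C" for b'
      using D(1)[OF b(1)] b C(2) B(1) that by (auto simp: point_or_avoiding_def)
    ultimately have "point_or_avoiding X c (D b) \<in> (\<Inter>b'\<in>C. K b')"
      using D(2)[OF b(1)] by (auto simp: K_def)
    then show ?thesis
      by blast
  qed
  have "\<Inter>(K ` B) \<noteq> {}"
  proof (rule compact_space_family_space[of X, unfolded compact_space_fip, rule_format],
      intro conjI ballI allI impI)
    fix S assume "S \<in> K ` B"
    then show "closedin (family_space X) S"
      using closed by blast
  next
    fix \<S> assume "finite \<S> \<and> \<S> \<subseteq> K ` B"
    then obtain C where "C \<subseteq> B" "finite C" "\<S> = K ` C"
      using finite_subset_image by metis
    then show "\<Inter>\<S> \<noteq> {}"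
      using fip by simp
  qed
  then obtain x where x: "\<And>b'. b' \<in> B \<Longrightarrow> x \<in> K b'"
    by blast
  obtain b where "b \<in> B"
    using B(2) by (metis finite.emptyI ex_in_conv)
  then have "x \<in> Top X" "B \<notin> x"
    using x[of b] F(2) by (auto simp: K_def)
  then have "istopology (\<lambda>U. U \<in> x)"
    by (simp add: Top_iff_istopology)
  moreover have "\<forall>U \<in> (\<lambda>b. {b}) ` B. U \<in> x"
    using x by (auto simp: K_def)
  ultimately have "\<Union>((\<lambda>b. {b}) ` B) \<in> x"
    by (simp only: istopology_def)
  then show False
    using \<open>B \<notin> x\<close> by simp
qed

lemma infinite_disjoint_infinite_blocks:
  assumes "infinite A"
  obtains B :: "nat \<Rightarrow> 'a set"
  where "\<And>n. B n \<subseteq> A" "\<And>n. infinite (B n)" "disjoint_family B"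
proof -
  obtain e :: "nat \<Rightarrow> 'a" where e: "inj e" "range e \<subseteq> A"
    using infinite_countable_subset[OF assms] by blast
  define B where "B n = range (\<lambda>j. e (prod_encode (n, j)))" for n
  show thesis
  proof
    show "B n \<subseteq> A" for n
      using e(2) by (auto simp: B_def)
    have "inj (\<lambda>j. e (prod_encode (n, j)))" for n
      by (rule injI) (simp add: inj_eq[OF e(1)])
    then show "infinite (B n)" for n
      unfolding B_def by (rule range_inj_infinite)
    show "disjoint_family B"
      by (auto simp: B_def disjoint_family_on_def inj_eq[OF e(1)])
  qed
qed

theorem theorem4p5:
  fixes X :: "'a set"
  assumes "infinite X"
  shows "\<not> fsigma_in (family_space X) (Top X)"
proof
  assume "fsigma_in (family_space X) (Top X)"
  then obtain F :: "nat \<Rightarrow> 'a set set set"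
    where F: "\<And>n. closedin (family_space X) (F n)" "(\<Union>n. F n) = Top X"
    unfolding fsigma_in_ascending by blast
  obtain c where c: "c \<in> X"
    using assms by (metis finite.emptyI ex_in_conv)
  obtain B :: "nat \<Rightarrow> 'a set" where B: "\<And>n. B n \<subseteq> X - {c}" "\<And>n. infinite (B n)"
      "disjoint_family B"
    using infinite_disjoint_infinite_blocks[of "X - {c}"] assms by auto
  have "\<exists>b\<in>B n. \<forall>D. D \<inter> B n = {b} \<longrightarrow> point_or_avoiding X c D \<notin> F n" for n
  proof -
    have "F n \<subseteq> Top X" "B n \<subseteq> X" "c \<notin> B n"
      using F(2) B(1)[of n] by auto
    then obtain b where "b \<in> B n" "\<And>D. D \<inter> B n = {b} \<Longrightarrow> point_or_avoiding X c D \<notin> F n"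
      using closed_subset_of_Top_misses_trace[OF F(1) _ _ B(2)] by blast
    then show ?thesis
      by blast
  qed
  then obtain d where d: "\<And>n. d n \<in> B n"
      "\<And>n D. D \<inter> B n = {d n} \<Longrightarrow> point_or_avoiding X c D \<notin> F n"
    by metis
  have "range d \<inter> B n = {d n}" for n
  proof -
    have "m = n" if "d m \<in> B n" for m
      using d(1)[of m] that disjoint_family_onD[OF B(3), of m n] by auto
    then show ?thesis
      using d(1) by auto
  qed
  then have "point_or_avoiding X c (range d) \<notin> (\<Union>n. F n)"
    using d(2) by blast
  then show False
    using point_or_avoiding_in_Top[OF c] F(2) by metis
qed

end
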